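(* Let $n\ge3$, let $\lambda_1,\dots,\lambda_{n-2}\in\mathbb{R}\setminus\{0\}$ and let $M^n_{\underline\lambda}=(\mathbb{R}^n,g_{\underline\lambda})$ with coordinates $(s,t,x_1,\dots,x_{n-2})$ and $g_{\underline\lambda}=2\,ds\,dt+\sum_{j=1}^{n-2}\lambda_jx_j^2\,ds^2+\sum_{j=1}^{n-2}dx_j^2$. Trivialize its (unique) spin structure by the global orthonormal frame $(\mathfrak a_{\bar0},\mathfrak a_0,\mathfrak a_1,\dots,\mathfrak a_{n-2})$ described in the context, so that spinor fields are smooth functions $M^n_{\underline\lambda}\to\Delta_{n,1}$. Then the space of parallel spinors of $M^n_{\underline\lambda}$ is $$\mathcal P(M_{\underline\lambda})=\{\varphi\in C^\infty(M_{\underline\lambda},\Delta_{n,1})\mid \varphi\equiv v \text{ constant with } v\in\Delta_V\},$$ where $\Delta_V=\{v\in\Delta_{n,1}\mid (e_2-e_1)\cdot v=0\}$. In particular $\dim_{\mathbb C}\mathcal P(M_{\underline\lambda})=\frac12\cdot2^{[n/2]}$.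
   Context: The global orthonormal frame is $\mathfrak a_{\bar0}=\partial_s-\frac12(\sum_j\lambda_jx_j^2+1)\partial_t$ (timelike), $\mathfrak a_0=\partial_s-\frac12(\sum_j\lambda_jx_j^2-1)\partial_t$, $\mathfrak a_j=\partial_{x_j}$ ($j=1,\dots,n-2$). $\Delta_{n,1}=\mathbb C^{2^{[n/2]}}$ is the complex spinor module of $\mathrm{Spin}(n,1)$, where the Clifford algebra is generated by an orthonormal basis $e_1,\dots,e_n$ of $\mathbb R^n$ with relations $e_ie_j+e_je_i=-2\varepsilon_j\delta_{ij}$, $\varepsilon_1=-1$, $\varepsilon_j=1$ for $j\ge2$. In the trivialization, Clifford multiplication by $\mathfrak a_{\bar0},\mathfrak a_0,\mathfrak a_j$ corresponds to the action of $e_1,e_2,e_{j+2}$ respectively; thus $e_2-e_1$ corresponds to the parallel isotropic field $V=\partial_t=\mathfrak a_0-\mathfrak a_{\bar0}$. A spinor field is parallel if $\nabla^S\varphi=0$ for the spinor derivative induced by the Levi-Civita connection. *)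

theory Defs
  imports "HOL-Analysis.Analysis" "HOL-Library.Function_Algebras"
begin

text \<open>Points of M = R^n, n = CARD('m) + 2, with coordinates (s, t, x), x in R^(n-2).\<close>
type_synonym 'm pt = "real \<times> real \<times> (real^'m)"

text \<open>Index set of the global orthonormal frame (a_bar0, a_0, a_1, ..., a_(n-2)),
  corresponding to the Clifford generators e_1, e_2, e_3, ..., e_n.\<close>
datatype 'm fidx = Bar0 | Zero | Xc 'm

lemma UNIV_fidx: "(UNIV :: 'm fidx set) = {Bar0, Zero} \<union> range Xc"
  by (auto intro: fidx.exhaust)

instance fidx :: (finite) finite
  by standard (simp add: UNIV_fidx)

text \<open>Signature: eps Bar0 = -1 (timelike, e_1), all others +1.\<close>
definition eps :: "'m fidx \<Rightarrow> real" where
  "eps i = (if i = Bar0 then -1 else 1)"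

text \<open>sum_j lambda_j x_j^2\<close>
definition Fq :: "real^('m::finite) \<Rightarrow> 'm pt \<Rightarrow> real" where
  "Fq lam p = (\<Sum>j\<in>UNIV. lam$j * ((snd (snd p))$j)^2)"

text \<open>The metric g = 2 ds dt + (sum_j lambda_j x_j^2) ds^2 + sum_j dx_j^2 at the point p.\<close>
definition gmet :: "real^('m::finite) \<Rightarrow> 'm pt \<Rightarrow> 'm pt \<Rightarrow> 'm pt \<Rightarrow> real" where
  "gmet lam p u w = fst u * fst (snd w) + fst (snd u) * fst w
      + Fq lam p * fst u * fst w + (snd (snd u)) \<bullet> (snd (snd w))"

text \<open>The global orthonormal frame.\<close>
definition frame :: "real^('m::finite) \<Rightarrow> 'm fidx \<Rightarrow> 'm pt \<Rightarrow> 'm pt" where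
  "frame lam k p = (case k of
      Bar0 \<Rightarrow> (1, -(1/2) * (Fq lam p + 1), 0)
    | Zero \<Rightarrow> (1, -(1/2) * (Fq lam p - 1), 0)
    | Xc j \<Rightarrow> (0, 0, axis j 1))"

text \<open>Directional derivative of f at p in direction v.\<close>
definition dder :: "('a::real_normed_vector \<Rightarrow> 'b::real_normed_vector) \<Rightarrow> 'a \<Rightarrow> 'a \<Rightarrow> 'b" where
  "dder f p v = frechet_derivative f (at p) v"

text \<open>Lie bracket of vector fields on M.\<close>
definition lie :: "(('m::finite) pt \<Rightarrow> 'm pt) \<Rightarrow> ('m pt \<Rightarrow> 'm pt) \<Rightarrow> 'm pt \<Rightarrow> 'm pt" where
  "lie X Y p = dder Y p (X p) - dder X p (Y p)"

text \<open>Koszul formula: the value g(nabla_X Y, Z)(p) for the Levi-Civita connection nabla of g.\<close>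
definition LC :: "real^('m::finite) \<Rightarrow> ('m pt \<Rightarrow> 'm pt) \<Rightarrow> ('m pt \<Rightarrow> 'm pt) \<Rightarrow> ('m pt \<Rightarrow> 'm pt) \<Rightarrow> 'm pt \<Rightarrow> real" where
  "LC lam X Y Z p = (1/2) *
     ( dder (\<lambda>q. gmet lam q (Y q) (Z q)) p (X p)
     + dder (\<lambda>q. gmet lam q (Z q) (X q)) p (Y p)
     - dder (\<lambda>q. gmet lam q (X q) (Y q)) p (Z p)
     + gmet lam p (lie X Y p) (Z p)
     - gmet lam p (lie Y Z p) (X p)
     - gmet lam p (lie X Z p) (Y p))"

text \<open>Connection forms omega_ij(a_k) = g(nabla_(a_k) a_i, a_j).\<close>
definition omega :: "real^('m::finite) \<Rightarrow> 'm fidx \<Rightarrow> 'm fidx \<Rightarrow> 'm fidx \<Rightarrow> 'm pt \<Rightarrow> real" where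
  "omega lam k i j p = LC lam (frame lam k) (frame lam i) (frame lam j) p"

text \<open>Clifford relations e_i e_j + e_j e_i = -2 eps_j delta_ij on the spinor module.\<close>
definition is_clifford :: "('m fidx \<Rightarrow> complex^'s^'s) \<Rightarrow> bool" where
  "is_clifford E \<longleftrightarrow> (\<forall>i j. E i ** E j + E j ** E i =
      (if i = j then mat (complex_of_real (-2 * eps i)) else 0))"

text \<open>Spinor derivative in the trivialization given by the frame:
  nabla^S_(a_k) phi = a_k(phi) + 1/2 sum_(i<j) eps_i eps_j omega_ij(a_k) e_i e_j phi,
  written equivalently as 1/4 times the full double sum.\<close>
definition nablaS :: "real^('m::finite) \<Rightarrow> ('m fidx \<Rightarrow> complex^'s^'s) \<Rightarrow> 'm fidx
    \<Rightarrow> ('m pt \<Rightarrow> complex^'s) \<Rightarrow> 'm pt \<Rightarrow> complex^'s" where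
  "nablaS lam E k phi p = dder phi p (frame lam k p)
     + (\<Sum>i\<in>UNIV. \<Sum>j\<in>UNIV.
          complex_of_real ((1/4) * eps i * eps j * omega lam k i j p) *s ((E i ** E j) *v phi p))"

text \<open>C^k maps between real normed vector spaces, and C^infinity.\<close>
fun Ck :: "nat \<Rightarrow> ('a::real_normed_vector \<Rightarrow> 'b::real_normed_vector) \<Rightarrow> bool" where
  "Ck 0 f = continuous_on UNIV f"
| "Ck (Suc k) f = (\<exists>f'. (\<forall>x. (f has_derivative f' x) (at x)) \<and> (\<forall>v. Ck k (\<lambda>x. f' x v)))"

definition smooth :: "('a::real_normed_vector \<Rightarrow> 'b::real_normed_vector) \<Rightarrow> bool" where
  "smooth f \<longleftrightarrow> (\<forall>k. Ck k f)"

text \<open>The space of parallel spinors.\<close>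
definition parallel_spinors :: "real^('m::finite) \<Rightarrow> ('m fidx \<Rightarrow> complex^'s^'s) \<Rightarrow> ('m pt \<Rightarrow> complex^'s) set" where
  "parallel_spinors lam E = {phi. smooth phi \<and> (\<forall>k p. nablaS lam E k phi p = 0)}"

text \<open>Delta_V = {v. (e_2 - e_1) . v = 0}.\<close>
definition DeltaV :: "('m fidx \<Rightarrow> complex^'s^'s) \<Rightarrow> (complex^'s) set" where
  "DeltaV E = {v. (E Zero - E Bar0) *v v = 0}"

text \<open>Complex scalar multiplication on spinor fields.\<close>
definition fscale :: "complex \<Rightarrow> ('m pt \<Rightarrow> complex^'s) \<Rightarrow> ('m pt \<Rightarrow> complex^'s)" where
  "fscale c f = (\<lambda>p. c *s f p)"

end

theory Submission
  imports Defs
begin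

text \<open>
  In the frame only the t-components vary, through F = sum_j lambda_j x_j^2, so the Koszul
  formula gives omega_ij(a_k) = ds(a_k) (ds(a_j) a_i(F) - ds(a_i) a_j(F)) / 2. Since
  V = e_2 - e_1 anticommutes with the e_(j+2), the spinor derivative becomes
  nabla_(a_k) phi = a_k(phi) + ds(a_k)/2 X V phi with X = sum_j lambda_j x_j e_(j+2).
  For a parallel phi the derivatives along the a_j and along a_0 - a_bar0 = d_t vanish
  everywhere, and the one along a_0 vanishes where x = 0, so phi is a constant v; at x = e_j
  the equation reads lambda_j e_(j+2) V v = 0, i.e. V v = 0, and conversely such constants
  are parallel. Finally V V = 0 and V W + W V = -4 for W = e_2 + e_1, so ker V and its image
  under W are complementary subspaces of equal dimension.
\<close>

lemma mat_vector_mult: "mat c *v x = c *s (x::'a::comm_ring_1^'n)"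
  by (simp add: vec_eq_iff matrix_vector_mult_def mat_def if_distrib[of "\<lambda>z. z * _"] cong: if_cong)

lemma dim_kernel_square_zero:
  fixes N P :: "'a::field^'n^'n"
  assumes NN: "\<And>v. N *v (N *v v) = 0"
    and NP: "\<And>v. N *v (P *v v) + P *v (N *v v) = c *s v"
    and "c \<noteq> 0"
  shows "2 * vec.dim {v. N *v v = 0} = CARD('n)"
proof -
  define K where "K = {v. N *v v = 0}"
  define T where "T = (*v) P ` K"
  have subK: "vec.subspace K"
    unfolding K_def by (rule vec.subspace_kernel)
  have subT: "vec.subspace T"
    unfolding T_def by (rule vec.subspace_image[OF subK])
  have K_inter_PK: "w = 0" if "w \<in> K" "P *v w \<in> K" for w
  proof -
    have "c *s w = 0"
      using NP[of w] that by (simp add: K_def)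
    then show ?thesis
      using \<open>c \<noteq> 0\<close> by (simp add: vec_eq_iff)
  qed
  have "u \<in> {x + y |x y. x \<in> K \<and> y \<in> T}" for u
  proof -
    have "u = inverse c *s (N *v (P *v u)) + P *v (inverse c *s (N *v u))"
      using NP[of u] \<open>c \<noteq> 0\<close>
      by (simp add: vec.scale vector_add_ldistrib[symmetric])
    moreover have "inverse c *s (N *v (P *v u)) \<in> K" "inverse c *s (N *v u) \<in> K"
      by (simp_all add: K_def vec.scale NN)
    ultimately show ?thesis
      unfolding T_def by blast
  qed
  then have sum_UNIV: "{x + y |x y. x \<in> K \<and> y \<in> T} = UNIV"
    by blast
  have Int_zero: "K \<inter> T = {0}"
  proof
    show "K \<inter> T \<subseteq> {0}"
      using K_inter_PK by (force simp: T_def)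
    show "{0} \<subseteq> K \<inter> T"
      using subK subT by (simp add: vec.subspace_0)
  qed
  have "inj_on ((*v) P) K"
  proof (rule inj_onI)
    fix x y
    assume "x \<in> K" "y \<in> K" "P *v x = P *v y"
    then have "x - y \<in> K" "P *v (x - y) \<in> K"
      using subK by (simp_all add: vec.subspace_diff vec.diff vec.subspace_0)
    then show "x = y"
      using K_inter_PK[of "x - y"] by simp
  qed
  then have "inj_on ((*v) P) (vec.span K)"
    using subK by (metis vec.span_eq_iff)
  then have "vec.dim T = vec.dim K"
    unfolding T_def by (rule vec.dim_image_eq[OF vec.linear_axioms])
  moreover have "vec.dim {x + y |x y. x \<in> K \<and> y \<in> T} + vec.dim (K \<inter> T) = vec.dim K + vec.dim T"
    by (rule vec.dim_sums_Int[OF subK subT])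
  ultimately have "vec.dim K + vec.dim K = CARD('n)"
    unfolding sum_UNIV Int_zero by (simp add: card_cart_basis)
  then show ?thesis
    by (simp add: K_def)
qed

lemma constant_if_partial_derivatives_vanish:
  fixes phi :: "real \<times> 'a::real_normed_vector \<Rightarrow> 'b::real_normed_vector"
  assumes deriv: "\<And>p. (phi has_derivative f' p) (at p)"
    and fibre: "\<And>p y. f' p (0, y) = 0"
    and base: "\<And>s. f' (s, 0) (1, 0) = 0"
  shows "phi p = phi 0"
proof -
  obtain s y where p: "p = (s, y)"
    by (cases p)
  have "((\<lambda>y. (s, y)) has_derivative (\<lambda>h. (0, h))) (at y)" for y :: 'a
    by (auto intro!: derivative_eq_intros)
  then have "((\<lambda>y. phi (s, y)) has_derivative (\<lambda>h. 0)) (at y within UNIV)" for y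
    using has_derivative_compose[OF _ deriv] fibre by fastforce
  then obtain c where "\<forall>y\<in>UNIV. phi (s, y) = c"
    using has_derivative_zero_constant[OF convex_UNIV] by blast
  then have "phi (s, y) = phi (s, 0)"
    by simp
  have "f' (r, 0) (h, 0) = h *\<^sub>R f' (r, 0) (1, 0)" for r h
  proof -
    have "(h, 0) = h *\<^sub>R (1, 0 :: 'a)"
      by simp
    then show ?thesis
      by (metis linear_scale[OF has_derivative_linear[OF deriv]])
  qed
  moreover have "((\<lambda>r. (r, 0)) has_derivative (\<lambda>h. (h, 0))) (at r)" for r :: real
    by (auto intro!: derivative_eq_intros)
  ultimately have "((\<lambda>r. phi (r, 0)) has_derivative (\<lambda>h. 0)) (at r within UNIV)" for r
    using has_derivative_compose[OF _ deriv] base by fastforce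
  then obtain c' where "\<forall>r\<in>UNIV. phi (r, 0) = c'"
    using has_derivative_zero_constant[OF convex_UNIV] by blast
  then show ?thesis
    using \<open>phi (s, y) = phi (s, 0)\<close> p by (simp add: zero_prod_def)
qed

lemma linear_vanishing_on_fibre:
  fixes f :: "('m::finite) pt \<Rightarrow> 'b::real_vector"
  assumes lin: "linear f" and "f (0, 1, 0) = 0" and "\<And>i. f (0, 0, axis i 1) = 0"
  shows "f (0, y) = 0"
proof -
  have "(\<lambda>y. f (0, y)) = (\<lambda>y. 0)"
  proof (rule linear_eq_stdbasis)
    show "linear (\<lambda>y. f (0, y))"
      by (rule linearI) (simp_all add: linear_add[OF lin, symmetric] linear_scale[OF lin, symmetric])
    fix b :: "real \<times> (real^'m)"
    assume "b \<in> Basis"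
    then consider "b = (1, 0)" | i where "b = (0, axis i 1)"
      by (auto simp: Basis_prod_def Basis_vec_def)
    then show "f (0, b) = 0"
      using assms(2,3) by cases (simp_all add: zero_prod_def)
  qed (rule linearI; simp)
  from fun_cong[OF this, of y] show ?thesis
    by simp
qed

lemma smooth_const: "smooth (\<lambda>x. c)"
proof -
  have "Ck k (\<lambda>x::'a::real_normed_vector. c :: 'b::real_normed_vector)" for k c
    by (induction k arbitrary: c) (auto intro!: exI[of _ "\<lambda>x v. 0"])
  then show ?thesis
    by (simp add: smooth_def)
qed

lemma clifford_relation_vec:
  assumes "is_clifford E"
  shows "E i *v (E j *v u) + E j *v (E i *v u) = (if i = j then complex_of_real (-2 * eps i) *s u else 0)"
proof -
  have "E i *v (E j *v u) + E j *v (E i *v u) = (E i ** E j + E j ** E i) *v u"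
    by (simp add: matrix_vector_mul_assoc matrix_vector_mult_add_rdistrib)
  then show ?thesis
    using assms unfolding is_clifford_def by (simp add: mat_vector_mult)
qed

lemma clifford_square:
  assumes "is_clifford E"
  shows "E i *v (E i *v u) = complex_of_real (- eps i) *s u"
proof -
  have "(E i *v (E i *v u)) $ k + (E i *v (E i *v u)) $ k = complex_of_real (-2 * eps i) * u $ k" for k
    using arg_cong[OF clifford_relation_vec[OF assms, of i i u], of "\<lambda>v. v $ k"]
    by (simp only: vector_add_component vector_smult_component if_P[OF refl])
  then show ?thesis
    by (simp add: vec_eq_iff field_simps)
qed

lemma clifford_anticomm:
  assumes "is_clifford E" "i \<noteq> j"
  shows "E i *v (E j *v u) = - (E j *v (E i *v u))"
  using clifford_relation_vec[OF assms(1), of i j u] assms(2) by (simp add: add_eq_0_iff)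

definition ds_frame :: "'m fidx \<Rightarrow> real" where
  "ds_frame k = (case k of Xc a \<Rightarrow> 0 | _ \<Rightarrow> 1)"

definition half_dFq_frame :: "real^('m::finite) \<Rightarrow> 'm fidx \<Rightarrow> 'm pt \<Rightarrow> real" where
  "half_dFq_frame lam k p = (case k of Xc a \<Rightarrow> lam$a * snd (snd p) $ a | _ \<Rightarrow> 0)"

definition dFq :: "real^('m::finite) \<Rightarrow> 'm pt \<Rightarrow> 'm pt \<Rightarrow> real" where
  "dFq lam p w = (\<Sum>j\<in>UNIV. lam$j * (2 * snd (snd p) $ j * snd (snd w) $ j))"

lemma has_derivative_x_component [derivative_intros]:
  "((\<lambda>p::'m::finite pt. snd (snd p) $ j) has_derivative (\<lambda>w. snd (snd w) $ j)) F"
  by (intro bounded_linear_imp_has_derivative bounded_linear_compose[OF bounded_linear_vec_nth]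
      bounded_linear_compose[OF bounded_linear_snd bounded_linear_snd])

lemma has_derivative_Fq: "(Fq lam has_derivative dFq lam p) (at p)"
  unfolding Fq_def[abs_def] dFq_def
  by (auto intro!: derivative_eq_intros simp: fun_eq_iff ac_simps)

lemma has_derivative_frame:
  "(frame lam k has_derivative (\<lambda>w. (0, - ds_frame k * dFq lam p w / 2, 0))) (at p)"
  by (cases k) (auto intro!: derivative_eq_intros has_derivative_Fq
      simp: frame_def[abs_def] ds_frame_def zero_prod_def)

lemma dder_frame: "dder (frame lam k) p w = (0, - ds_frame k * dFq lam p w / 2, 0)"
  unfolding dder_def frechet_derivative_at[OF has_derivative_frame, symmetric] ..

lemma dder_const: "dder (\<lambda>q. c) p w = 0"
  unfolding dder_def frechet_derivative_at[OF has_derivative_const, symmetric] ..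

lemma dFq_frame: "dFq lam p (frame lam k p) = 2 * half_dFq_frame lam k p"
  by (cases k) (auto simp: dFq_def frame_def half_dFq_frame_def axis_def if_distrib cong: if_cong)

lemma gmet_frame: "gmet lam q (frame lam i q) (frame lam j q) = (if i = j then eps i else 0)"
  by (cases i; cases j) (auto simp: gmet_def frame_def eps_def inner_axis_axis field_simps)

lemma gmet_dt_frame: "gmet lam p (0, c, 0) (frame lam k p) = c * ds_frame k"
  by (cases k) (auto simp: gmet_def frame_def ds_frame_def)

lemma lie_frame:
  "lie (frame lam i) (frame lam j) p
     = (0, ds_frame i * half_dFq_frame lam j p - ds_frame j * half_dFq_frame lam i p, 0)"
  by (simp add: lie_def dder_frame dFq_frame algebra_simps)

lemma omega_frame:
  "omega lam k i j p
     = ds_frame k * (ds_frame j * half_dFq_frame lam i p - ds_frame i * half_dFq_frame lam j p)"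
  unfolding omega_def LC_def gmet_frame dder_const lie_frame gmet_dt_frame
  by (simp add: algebra_simps)

definition clifford_V :: "('m fidx \<Rightarrow> complex^'s^'s) \<Rightarrow> complex^'s \<Rightarrow> complex^'s" where
  "clifford_V E w = (E Zero - E Bar0) *v w"

definition clifford_X ::
    "real^('m::finite) \<Rightarrow> ('m fidx \<Rightarrow> complex^'s^'s) \<Rightarrow> 'm pt \<Rightarrow> complex^'s \<Rightarrow> complex^'s" where
  "clifford_X lam E p w = (\<Sum>a\<in>UNIV. complex_of_real (lam$a * snd (snd p) $ a) *s (E (Xc a) *v w))"

lemma sum_fidx: "sum f (UNIV :: ('m::finite) fidx set) = f Bar0 + f Zero + (\<Sum>a\<in>UNIV. f (Xc a))"
proof -
  have "sum f (UNIV :: 'm fidx set) = sum f {Bar0, Zero} + sum f (range Xc)"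
    unfolding UNIV_fidx by (rule sum.union_disjoint) auto
  also have "sum f (range Xc) = (\<Sum>a\<in>UNIV. f (Xc a))"
    by (subst sum.reindex) (auto simp: inj_on_def)
  finally show ?thesis
    by simp
qed

lemma sum_ds_frame_clifford:
  fixes E :: "('m::finite) fidx \<Rightarrow> complex^'s^'s"
  shows "(\<Sum>j\<in>UNIV. complex_of_real (eps j * ds_frame j) *s (E j *v w)) = clifford_V E w"
  unfolding sum_fidx by (simp add: eps_def ds_frame_def clifford_V_def matrix_vector_mult_diff_rdistrib)

lemma sum_half_dFq_frame_clifford:
  "(\<Sum>i\<in>UNIV. complex_of_real (eps i * half_dFq_frame lam i p) *s (E i *v w)) = clifford_X lam E p w"
  unfolding sum_fidx by (simp add: eps_def half_dFq_frame_def clifford_X_def)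

lemma sum_product_clifford:
  "(\<Sum>i\<in>UNIV. \<Sum>j\<in>UNIV. complex_of_real (a i * b j) *s (E i *v (E j *v w)))
   = (\<Sum>i\<in>UNIV. complex_of_real (a i) *s (E i *v (\<Sum>j\<in>UNIV. complex_of_real (b j) *s (E j *v w))))"
  by (simp add: vec.sum vector_scalar_commute vec.scale_sum_right)

lemma spin_connection_frame:
  "(\<Sum>i\<in>UNIV. \<Sum>j\<in>UNIV.
      complex_of_real ((1/4) * eps i * eps j * omega lam k i j p) *s ((E i ** E j) *v w))
   = complex_of_real (ds_frame k / 4) *s
       (clifford_X lam E p (clifford_V E w) - clifford_V E (clifford_X lam E p w))"
proof -
  let ?c = "complex_of_real (ds_frame k / 4)"
  have "(\<Sum>i\<in>UNIV. \<Sum>j\<in>UNIV.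
      complex_of_real ((1/4) * eps i * eps j * omega lam k i j p) *s ((E i ** E j) *v w))
    = (\<Sum>i\<in>UNIV. \<Sum>j\<in>UNIV. ?c *s
        (complex_of_real ((eps i * half_dFq_frame lam i p) * (eps j * ds_frame j)) *s (E i *v (E j *v w))
       - complex_of_real ((eps i * ds_frame i) * (eps j * half_dFq_frame lam j p)) *s (E i *v (E j *v w))))"
    by (intro sum.cong refl) (simp add: omega_frame matrix_vector_mul_assoc vec_eq_iff algebra_simps)
  also have "\<dots> = ?c *s
      ((\<Sum>i\<in>UNIV. \<Sum>j\<in>UNIV. complex_of_real ((eps i * half_dFq_frame lam i p) * (eps j * ds_frame j))
          *s (E i *v (E j *v w)))
      - (\<Sum>i\<in>UNIV. \<Sum>j\<in>UNIV. complex_of_real ((eps i * ds_frame i) * (eps j * half_dFq_frame lam j p))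
          *s (E i *v (E j *v w))))"
    by (simp add: vec.scale_sum_right sum_subtractf vec.scale_right_diff_distrib)
  also have "\<dots> = ?c *s (clifford_X lam E p (clifford_V E w) - clifford_V E (clifford_X lam E p w))"
    unfolding sum_product_clifford sum_ds_frame_clifford sum_half_dFq_frame_clifford
    by (simp add: clifford_V_def clifford_X_def matrix_vector_mult_diff_rdistrib)
  finally show ?thesis .
qed

lemma clifford_V_X_anticomm:
  assumes "is_clifford E"
  shows "clifford_V E (clifford_X lam E p w) = - clifford_X lam E p (clifford_V E w)"
proof -
  let ?c = "\<lambda>a. complex_of_real (lam$a * snd (snd p) $ a)"
  have anticomm: "clifford_V E (E (Xc a) *v w) = - (E (Xc a) *v clifford_V E w)" for a
    using clifford_anticomm[OF assms, of "Xc a" Zero w] clifford_anticomm[OF assms, of "Xc a" Bar0 w]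
    by (simp add: clifford_V_def matrix_vector_mult_diff_rdistrib vec.diff)
  have "clifford_V E (clifford_X lam E p w) = (\<Sum>a\<in>UNIV. ?c a *s clifford_V E (E (Xc a) *v w))"
    by (simp add: clifford_V_def clifford_X_def vec.sum vec.scale)
  also have "\<dots> = - clifford_X lam E p (clifford_V E w)"
    by (simp add: anticomm clifford_X_def sum_negf[symmetric])
  finally show ?thesis .
qed

lemma nablaS_frame:
  assumes "is_clifford E"
  shows "nablaS lam E k phi p
    = dder phi p (frame lam k p) + complex_of_real (ds_frame k / 2) *s clifford_X lam E p (clifford_V E (phi p))"
  unfolding nablaS_def spin_connection_frame clifford_V_X_anticomm[OF assms]
  by (simp add: vec_eq_iff)

lemma clifford_X_origin: "clifford_X lam E (s, t, 0) w = 0"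
  by (simp add: clifford_X_def)

lemma clifford_X_axis: "clifford_X lam E (s, t, axis a 1) w = complex_of_real (lam$a) *s (E (Xc a) *v w)"
proof -
  have "complex_of_real (lam$b * axis a 1 $ b) *s (E (Xc b) *v w)
     = (if b = a then complex_of_real (lam$a) *s (E (Xc a) *v w) else 0)" for b
    by (auto simp: axis_def)
  then show ?thesis
    by (simp add: clifford_X_def)
qed

lemma constant_parallel_iff:
  fixes lam :: "real^('m::finite)" and E :: "'m fidx \<Rightarrow> complex^'s^'s"
  assumes cl: "is_clifford E" and "\<forall>j. lam$j \<noteq> 0"
  shows "(\<lambda>p. v) \<in> parallel_spinors lam E \<longleftrightarrow> clifford_V E v = 0"
proof
  assume "(\<lambda>p. v) \<in> parallel_spinors lam E"
  then have "nablaS lam E Zero (\<lambda>p. v) (0, 0, axis a 1) = 0" for a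
    by (simp add: parallel_spinors_def)
  then have "E (Xc a) *v clifford_V E v = 0" for a
    using assms(2) by (simp add: nablaS_frame[OF cl] dder_const clifford_X_axis ds_frame_def vec_eq_iff)
  then have "E (Xc a) *v (E (Xc a) *v clifford_V E v) = 0" for a
    by simp
  then show "clifford_V E v = 0"
    by (simp add: clifford_square[OF cl] eps_def)
next
  assume "clifford_V E v = 0"
  then show "(\<lambda>p. v) \<in> parallel_spinors lam E"
    by (simp add: parallel_spinors_def smooth_const nablaS_frame[OF cl] dder_const clifford_X_def)
qed

lemma parallel_spinor_constant:
  fixes lam :: "real^('m::finite)" and E :: "'m fidx \<Rightarrow> complex^'s^'s"
  assumes cl: "is_clifford E" and "phi \<in> parallel_spinors lam E"
  shows "phi p = phi 0"
proof -
  have "Ck (Suc 0) phi"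
    using assms(2) by (simp add: parallel_spinors_def smooth_def)
  then obtain f' where deriv: "\<And>p. (phi has_derivative f' p) (at p)"
    by auto
  have lin: "linear (f' p)" for p
    using deriv has_derivative_linear by blast
  have "nablaS lam E k phi p = 0" for k p
    using assms(2) unfolding parallel_spinors_def by blast
  then have frame_deriv: "f' p (frame lam k p)
      = - (complex_of_real (ds_frame k / 2) *s clifford_X lam E p (clifford_V E (phi p)))" for k p
    unfolding nablaS_frame[OF cl] dder_def frechet_derivative_at[OF deriv, symmetric]
    by (simp add: eq_neg_iff_add_eq_0)
  have dt: "f' p (0, 1, 0) = 0" for p
  proof -
    have "(0, 1, 0) = frame lam Zero p - frame lam Bar0 p"
      by (simp add: frame_def field_simps)
    then have "f' p (0, 1, 0) = f' p (frame lam Zero p) - f' p (frame lam Bar0 p)"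
      by (simp add: linear_diff[OF lin])
    then show ?thesis
      using frame_deriv[of p Zero] frame_deriv[of p Bar0] by (simp add: ds_frame_def)
  qed
  moreover have "f' p (0, 0, axis i 1) = 0" for p i
    using frame_deriv[of p "Xc i"] by (simp add: frame_def ds_frame_def)
  ultimately have "f' p (0, y) = 0" for p y
    using linear_vanishing_on_fibre[OF lin] by blast
  moreover have "f' (s, 0) (1, 0) = 0" for s
  proof -
    have s_direction: "(1, 0, 0) = frame lam Zero (s, 0, 0) - (1/2) *\<^sub>R (0, 1, 0 :: real^'m)"
      by (simp add: frame_def Fq_def zero_prod_def)
    have "f' (s, 0, 0) (1, 0, 0)
        = f' (s, 0, 0) (frame lam Zero (s, 0, 0)) - (1/2) *\<^sub>R f' (s, 0, 0) (0, 1, 0)"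
      unfolding s_direction linear_diff[OF lin] linear_scale[OF lin] ..
    then show ?thesis
      using frame_deriv[of "(s, 0, 0)" Zero] dt[of "(s, 0, 0)"]
      by (simp add: clifford_X_origin zero_prod_def)
  qed
  ultimately show ?thesis
    by (rule constant_if_partial_derivatives_vanish[OF deriv])
qed

lemma parallel_spinors_eq_constants:
  fixes lam :: "real^('m::finite)" and E :: "'m fidx \<Rightarrow> complex^'s^'s"
  assumes "is_clifford E" and "\<forall>j. lam$j \<noteq> 0"
  shows "parallel_spinors lam E = (\<lambda>v p. v) ` DeltaV E"
proof (intro set_eqI iffI)
  fix phi
  assume par: "phi \<in> parallel_spinors lam E"
  define v where "v = phi 0"
  have "phi = (\<lambda>p. v)"
    unfolding v_def by (rule ext) (rule parallel_spinor_constant[OF assms(1) par])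
  moreover have "v \<in> DeltaV E"
    using par calculation constant_parallel_iff[OF assms] by (simp add: DeltaV_def clifford_V_def)
  ultimately show "phi \<in> (\<lambda>v p. v) ` DeltaV E"
    by blast
next
  fix phi :: "'m pt \<Rightarrow> complex^'s"
  assume "phi \<in> (\<lambda>v p. v) ` DeltaV E"
  then show "phi \<in> parallel_spinors lam E"
    using constant_parallel_iff[OF assms] unfolding DeltaV_def clifford_V_def by auto
qed

interpretation spinor_fields: vector_space "fscale :: complex \<Rightarrow> (('m::finite) pt \<Rightarrow> complex^'s) \<Rightarrow> _"
  by unfold_locales (auto simp: fscale_def fun_eq_iff)

lemma dim_constant_spinor_fields:
  "vector_space.dim (fscale :: complex \<Rightarrow> (('m::finite) pt \<Rightarrow> complex^'s) \<Rightarrow> _) ((\<lambda>v p. v) ` S)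
   = vec.dim S"
proof -
  have "finite_dimensional_vector_space_pair_1 (*s) (cart_basis :: (complex^'s) set)
      (fscale :: complex \<Rightarrow> ('m pt \<Rightarrow> complex^'s) \<Rightarrow> _)"
    by (rule finite_dimensional_vector_space_pair_1.intro[OF
          vec.finite_dimensional_vector_space_pair_1_axioms[THEN finite_dimensional_vector_space_pair_1.axioms(1)]
          spinor_fields.vector_space_axioms])
  moreover have "Vector_Spaces.linear (*s) (fscale :: complex \<Rightarrow> ('m pt \<Rightarrow> complex^'s) \<Rightarrow> _) (\<lambda>v p. v)"
    by unfold_locales (auto simp: fscale_def fun_eq_iff)
  ultimately show ?thesis
    by (rule finite_dimensional_vector_space_pair_1.dim_image_eq) (auto simp: inj_on_def fun_eq_iff)
qed

lemma dim_DeltaV: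
  fixes E :: "('m::finite) fidx \<Rightarrow> complex^'s^'s"
  assumes cl: "is_clifford E"
  shows "2 * vec.dim (DeltaV E) = CARD('s)"
  unfolding DeltaV_def
proof (rule dim_kernel_square_zero)
  have anticomm: "E Zero *v (E Bar0 *v u) = - (E Bar0 *v (E Zero *v u))" for u
    using clifford_anticomm[OF cl, of Zero Bar0 u] by simp
  show "(E Zero - E Bar0) *v ((E Zero - E Bar0) *v v) = 0" for v
    by (simp add: matrix_vector_mult_diff_rdistrib vec.diff anticomm clifford_square[OF cl] eps_def)
  show "(E Zero - E Bar0) *v ((E Zero + E Bar0) *v v) + (E Zero + E Bar0) *v ((E Zero - E Bar0) *v v)
      = (-4) *s v" for v
    by (simp add: matrix_vector_mult_diff_rdistrib matrix_vector_mult_add_rdistrib vec.diff vec.add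
        anticomm clifford_square[OF cl] eps_def vec_eq_iff)
qed simp

theorem proposition5:
  fixes lam :: "real^'m" and E :: "'m fidx \<Rightarrow> complex^'s^'s"
  assumes "\<forall>j. lam$j \<noteq> 0"
    and "CARD('s) = 2 ^ ((CARD('m) + 2) div 2)"
    and "is_clifford E"
  shows "parallel_spinors lam E = {phi. \<exists>v\<in>DeltaV E. \<forall>p. phi p = v}
         \<and> vector_space.dim fscale (parallel_spinors lam E) = 2 ^ ((CARD('m) + 2) div 2) div 2"
proof
  show "parallel_spinors lam E = {phi. \<exists>v\<in>DeltaV E. \<forall>p. phi p = v}"
    unfolding parallel_spinors_eq_constants[OF assms(3,1)] by (auto simp: fun_eq_iff)
  have "vector_space.dim fscale (parallel_spinors lam E) = vec.dim (DeltaV E)"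
    unfolding parallel_spinors_eq_constants[OF assms(3,1)] by (rule dim_constant_spinor_fields)
  then show "vector_space.dim fscale (parallel_spinors lam E) = 2 ^ ((CARD('m) + 2) div 2) div 2"
    using dim_DeltaV[OF assms(3)] assms(2) by simp
qed

end
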